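(* Let $D$ be a complete valued division ring of characteristic $0$ whose unit sphere $\{d\in D:|d|=1\}$ is compact. Let $f:D\to D$ be differentiable in the Gâteaux sense at a point $x\in D$, with Gâteaux $D\star$-derivative $\frac{\partial f(x)(a)}{\partial_* x}$ ($a\in D$, $a\ne 0$). If the map $a\mapsto \frac{\partial f(x)(a)}{\partial_* x}$ is continuous in direction over $\mathbb R$, then $f$ is continuous at the point $x$.
   Context: A valued division ring is a division ring $D$ with a map $|\cdot|:D\to\mathbb R$ satisfying $|a|\ge0$, $|a|=0\iff a=0$, $|ab|=|a||b|$, $|a+b|\le|a|+|b|$. It is assumed that $|\cdot|$ restricts to the usual absolute value on $\mathbb Q\subset D$; since $D$ is complete, $\mathbb R$ is then contained in the center of $D$. The map $f$ is differentiable in the Gâteaux sense at $x$ if $f(x+a)-f(x)=\partial f(x)(a)+o(a)$ for all $a$, where the Gâteaux derivative $\partial f(x):D\to D$ is an $\mathbb R$-linear map and $o:D\to D$ is a continuous map with $\lim_{a\to0}|o(a)|/|a|=0$. The Gâteaux $D\star$-derivative is defined by $\partial f(x)(a)=a\,\frac{\partial f(x)(a)}{\partial_* x}$, i.e. $\frac{\partial f(x)(a)}{\partial_* x}=a^{-1}\partial f(x)(a)$ for $a\neq0$; it does not change when $a$ is replaced by $ra$, $r\in\mathbb R$, $r\neq0$. A map $\varphi$ on $D\setminus\{0\}$ with $\varphi(ra)=\varphi(a)$ for nonzero real $r$ is continuous in direction over $\mathbb R$ if for every $\epsilon>0$ there is $\delta>0$ such that $|a'-a|<\delta$, $|a'|=|a|=1$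 imply $|\varphi(a')-\varphi(a)|<\epsilon$ (equivalently, $\varphi$ is continuous on the unit sphere). *)

theory Defs
  imports "HOL-Analysis.Analysis"
begin

section \<open>Valued division rings\<close>

text \<open>
  The metric, and with it the topology, is the one induced by the absolute value. (The library
  constant \<open>norm\<close> is reserved for real normed vector spaces.)
\<close>

class valued_division_ring = division_ring + metric_space +
  fixes absval :: "'a \<Rightarrow> real"
  assumes value_nonneg: "absval a \<ge> 0"
    and value_eq_0_iff: "absval a = 0 \<longleftrightarrow> a = 0"
    and value_mult: "absval (a * b) = absval a * absval b"
    and value_triangle: "absval (a + b) \<le> absval a + absval b"
    and dist_absval: "dist a b = absval (a - b)"

lemma value_one: "absval (1::'a::valued_division_ring) = 1"
  using value_mult[of "1::'a" 1] value_eq_0_iff[of "1::'a"] by simp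

lemma value_minus: "absval (- a) = absval (a::'a::valued_division_ring)"
proof -
  have "absval (-1::'a) * absval (-1::'a) = 1"
    using value_mult[of "-1::'a" "-1"] value_one[where 'a='a] by (metis minus_mult_minus mult_1)
  hence "absval (-1::'a) = 1"
    using value_nonneg[of "-1::'a"] by (metis abs_of_nonneg abs_mult_self_eq real_sqrt_abs2 real_sqrt_one)
  thus ?thesis
    using value_mult[of "-1" a] by simp
qed

class rational_valued_division_ring = valued_division_ring + ring_char_0 +
  assumes value_rational: "n \<noteq> 0 \<Longrightarrow> absval (of_int m / of_int n) = \<bar>real_of_int m / real_of_int n\<bar>"

text \<open>
  The embedding of the real numbers into a complete ring of this kind: \<open>real_incl r\<close> is the
  common limit of (the images of) all sequences of rational numbers that converge to \<open>r\<close>.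
\<close>

definition real_incl :: "real \<Rightarrow> 'a::{rational_valued_division_ring, complete_space}" where
  "real_incl r = (THE c. \<forall>p q :: nat \<Rightarrow> int. (\<forall>n. q n \<noteq> 0) \<longrightarrow>
     (\<lambda>n. real_of_int (p n) / real_of_int (q n)) \<longlonglongrightarrow> r \<longrightarrow>
     (\<lambda>n. of_int (p n) / of_int (q n)) \<longlonglongrightarrow> c)"

definition real_scale ::
  "real \<Rightarrow> 'a \<Rightarrow> 'a::{rational_valued_division_ring, complete_space}" where
  "real_scale r a = real_incl r * a"

section \<open>The Gateaux derivative\<close>

definition has_gateaux_derivative ::
  "('a \<Rightarrow> 'a) \<Rightarrow> ('a \<Rightarrow> 'a) \<Rightarrow> 'a::{rational_valued_division_ring, complete_space} \<Rightarrow> bool" where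
  "has_gateaux_derivative f f' x \<longleftrightarrow>
     Vector_Spaces.linear real_scale real_scale f' \<and>
     (\<exists>r :: 'a \<Rightarrow> 'a. continuous_on UNIV r \<and> ((\<lambda>a. absval (r a) / absval a) \<longlongrightarrow> 0) (at 0) \<and>
        (\<forall>a. f (x + a) - f x = f' a + r a))"

definition gateaux_star :: "('a::division_ring \<Rightarrow> 'a) \<Rightarrow> 'a \<Rightarrow> 'a" where
  "gateaux_star f' a = inverse a * f' a"

text \<open>
  Meant for maps on the nonzero elements that are invariant under nonzero real scaling; the value
  at 0 is never used.
\<close>

definition continuous_in_direction :: "('a::valued_division_ring \<Rightarrow> 'a) \<Rightarrow> bool" where
  "continuous_in_direction \<phi> \<longleftrightarrow>
     (\<forall>\<epsilon>>0. \<exists>\<delta>>0. \<forall>a a'. absval (a' - a) < \<delta> \<and> absval a' = 1 \<and> absval a = 1 \<longrightarrow>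
        absval (\<phi> a' - \<phi> a) < \<epsilon>)"

section \<open>Basic facts\<close>

lemma tendsto_iff_value:
  fixes X :: "nat \<Rightarrow> 'a::valued_division_ring"
  shows "X \<longlonglongrightarrow> c \<longleftrightarrow> (\<lambda>n. absval (X n - c)) \<longlonglongrightarrow> 0"
  by (subst tendsto_dist_iff) (simp add: dist_absval)

lemma value_diff_triangle: "\<bar>absval a - absval b\<bar> \<le> absval (a - b :: 'a::valued_division_ring)"
  using value_triangle[of "a - b" b] value_triangle[of "b - a" a] value_minus[of "a - b"]
  by simp

lemma tendsto_value:
  fixes X :: "nat \<Rightarrow> 'a::valued_division_ring"
  assumes "X \<longlonglongrightarrow> c" shows "(\<lambda>n. absval (X n)) \<longlonglongrightarrow> absval c"
proof -
  have "(\<lambda>n. absval (X n) - absval c) \<longlonglongrightarrow> 0"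
    by (rule Lim_null_comparison[OF _ assms[unfolded tendsto_iff_value]])
       (simp add: value_diff_triangle)
  thus ?thesis by (simp add: LIM_zero_iff)
qed

lemma tendsto_value_add:
  fixes X Y :: "nat \<Rightarrow> 'a::valued_division_ring"
  assumes "X \<longlonglongrightarrow> c" "Y \<longlonglongrightarrow> d" shows "(\<lambda>n. X n + Y n) \<longlonglongrightarrow> c + d"
  unfolding tendsto_iff_value
proof (rule Lim_null_comparison)
  show "\<forall>\<^sub>F n in sequentially. norm (absval (X n + Y n - (c + d))) \<le> absval (X n - c) + absval (Y n - d)"
    using value_triangle[of "X _ - c" "Y _ - d"] by (simp add: algebra_simps value_nonneg)
  show "(\<lambda>n. absval (X n - c) + absval (Y n - d)) \<longlonglongrightarrow> 0"
    using tendsto_add[OF assms[unfolded tendsto_iff_value]] by simp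
qed

lemma tendsto_value_mult:
  fixes X Y :: "nat \<Rightarrow> 'a::valued_division_ring"
  assumes "X \<longlonglongrightarrow> c" "Y \<longlonglongrightarrow> d" shows "(\<lambda>n. X n * Y n) \<longlonglongrightarrow> c * d"
  unfolding tendsto_iff_value
proof (rule Lim_null_comparison)
  have "absval (X n * Y n - c * d) \<le> absval (X n) * absval (Y n - d) + absval (X n - c) * absval d" for n
    using value_triangle[of "X n * (Y n - d)" "(X n - c) * d"]
    unfolding value_mult by (simp add: algebra_simps)
  thus "\<forall>\<^sub>F n in sequentially.
      norm (absval (X n * Y n - c * d)) \<le> absval (X n) * absval (Y n - d) + absval (X n - c) * absval d"
    by (simp add: value_nonneg)
  show "(\<lambda>n. absval (X n) * absval (Y n - d) + absval (X n - c) * absval d) \<longlonglongrightarrow> 0"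
    using tendsto_add[OF tendsto_mult[OF tendsto_value[OF assms(1)] assms(2)[unfolded tendsto_iff_value]]
        tendsto_mult[OF assms(1)[unfolded tendsto_iff_value] tendsto_const[of "absval d"]]]
    by simp
qed

lemma of_int_inverse_commute:
  "inverse (of_int m) * y = y * inverse (of_int m :: 'a::division_ring)"
  by (rule mult_commute_imp_mult_inverse_commute) (rule mult_of_int_commute)

lemma frac_central:
  "of_int m / of_int n * y = y * (of_int m / of_int n :: 'a::division_ring)"
proof -
  have "of_int m * (inverse (of_int n) * y) = of_int m * (y * inverse (of_int n :: 'a))"
    by (simp only: of_int_inverse_commute[of n y])
  also have "\<dots> = y * of_int m * inverse (of_int n)"
    by (simp only: mult.assoc[symmetric] mult_of_int_commute[of m y])
  finally show ?thesis by (simp only: divide_inverse mult.assoc)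
qed

lemma frac_mult:
  assumes "n \<noteq> 0" "n' \<noteq> 0"
  shows "of_int m / of_int n * (of_int m' / of_int n')
       = (of_int (m * m') / of_int (n * n') :: 'a::{division_ring, ring_char_0})"
proof -
  have "inverse (of_int (n * n') :: 'a) = inverse (of_int n') * inverse (of_int n)"
    using assms by (simp add: nonzero_inverse_mult_distrib)
  moreover have "of_int m * inverse (of_int n) * (of_int m' * inverse (of_int n'))
      = of_int m * of_int m' * (inverse (of_int n') * inverse (of_int n) :: 'a)"
    using of_int_inverse_commute[of n "of_int m' * inverse (of_int n') :: 'a"]
    by (simp add: mult.assoc)
  ultimately show ?thesis
    by (simp only: divide_inverse of_int_mult)
qed

lemma frac_expand:
  assumes "n \<noteq> 0" "k \<noteq> 0"
  shows "of_int (m * k) / of_int (n * k) = (of_int m / of_int n :: 'a::{division_ring, ring_char_0})"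
  using frac_mult[OF assms, of m k, where 'a='a] assms by simp

lemma frac_add:
  assumes "n \<noteq> 0" "n' \<noteq> 0"
  shows "of_int m / of_int n + of_int m' / of_int n'
       = (of_int (m * n' + m' * n) / of_int (n * n') :: 'a::{division_ring, ring_char_0})"
  unfolding of_int_add add_divide_distrib frac_expand[OF assms]
  unfolding mult.commute[of n n'] frac_expand[OF assms(2,1)] ..

lemma frac_diff:
  assumes "n \<noteq> 0" "n' \<noteq> 0"
  shows "of_int m / of_int n - of_int m' / of_int n'
       = (of_int (m * n' - m' * n) / of_int (n * n') :: 'a::{division_ring, ring_char_0})"
  using frac_add[OF assms, of m "- m'", where 'a='a] by simp

lemma value_frac_diff:
  assumes "n \<noteq> 0" "n' \<noteq> 0"
  shows "absval (of_int m / of_int n - of_int m' / of_int n' :: 'a::rational_valued_division_ring)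
       = \<bar>real_of_int m / real_of_int n - real_of_int m' / real_of_int n'\<bar>"
  unfolding frac_diff[OF assms] using assms by (subst value_rational) auto

lemma rational_approx:
  obtains p q :: "nat \<Rightarrow> int" where "\<And>n. q n \<noteq> 0"
    "(\<lambda>n. real_of_int (p n) / real_of_int (q n)) \<longlonglongrightarrow> r"
proof
  show "int (Suc n) \<noteq> 0" for n by simp
  show "(\<lambda>n. real_of_int \<lfloor>r * real (Suc n)\<rfloor> / real_of_int (int (Suc n))) \<longlonglongrightarrow> r"
  proof (rule real_tendsto_sandwich)
    have "real_of_int \<lfloor>r * real (Suc n)\<rfloor> / real (Suc n) \<le> r" for n
      by (subst divide_le_eq) auto
    thus "\<forall>\<^sub>F n in sequentially. real_of_int \<lfloor>r * real (Suc n)\<rfloor> / real_of_int (int (Suc n)) \<le> r"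
      by simp
    have "r - 1 / real (Suc n) \<le> real_of_int \<lfloor>r * real (Suc n)\<rfloor> / real (Suc n)" for n
    proof (subst le_divide_eq, simp del: of_nat_Suc)
      have "(r - 1 / real (Suc n)) * real (Suc n) = r * real (Suc n) - 1"
        by (simp add: left_diff_distrib del: of_nat_Suc)
      thus "(r - 1 / real (Suc n)) * real (Suc n) \<le> real_of_int \<lfloor>r * real (Suc n)\<rfloor>"
        by linarith
    qed
    thus "\<forall>\<^sub>F n in sequentially.
        r - 1 / real (Suc n) \<le> real_of_int \<lfloor>r * real (Suc n)\<rfloor> / real_of_int (int (Suc n))"
      by simp
    show "(\<lambda>n. r - 1 / real (Suc n)) \<longlonglongrightarrow> r"
      using tendsto_diff[OF tendsto_const[of r] LIMSEQ_Suc[OF lim_1_over_n]] by simp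
  qed simp
qed

lemma real_incl_ex1:
  "\<exists>!c :: 'a::{rational_valued_division_ring, complete_space}.
     \<forall>p q :: nat \<Rightarrow> int. (\<forall>n. q n \<noteq> 0) \<longrightarrow>
       (\<lambda>n. real_of_int (p n) / real_of_int (q n)) \<longlonglongrightarrow> r \<longrightarrow>
       (\<lambda>n. of_int (p n) / of_int (q n)) \<longlonglongrightarrow> c"
proof -
  obtain p q :: "nat \<Rightarrow> int" where q: "\<And>n. q n \<noteq> 0"
    and lim: "(\<lambda>n. real_of_int (p n) / real_of_int (q n)) \<longlonglongrightarrow> r"
    by (rule rational_approx[of r], rule that)
  define X where "X n = (of_int (p n) / of_int (q n) :: 'a)" for n
  have "Cauchy (\<lambda>n. real_of_int (p n) / real_of_int (q n))"
    using lim by (rule LIMSEQ_imp_Cauchy)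
  hence "Cauchy X"
    unfolding Cauchy_def by (simp add: X_def dist_absval value_frac_diff q dist_real_def)
  then obtain c where c: "X \<longlonglongrightarrow> c"
    using Cauchy_convergent convergent_def by blast
  show ?thesis
  proof (rule ex1I[of _ c]; safe?)
    fix p' q' :: "nat \<Rightarrow> int" assume q': "\<forall>n. q' n \<noteq> 0"
      and lim': "(\<lambda>n. real_of_int (p' n) / real_of_int (q' n)) \<longlonglongrightarrow> r"
    have "(\<lambda>n. \<bar>real_of_int (p' n) / real_of_int (q' n) - real_of_int (p n) / real_of_int (q n)\<bar>) \<longlonglongrightarrow> 0"
      using tendsto_rabs[OF tendsto_diff[OF lim' lim]] by simp
    hence "(\<lambda>n. of_int (p' n) / of_int (q' n) - X n) \<longlonglongrightarrow> 0"
      by (subst tendsto_iff_value) (simp add: X_def value_frac_diff q q')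
    from tendsto_value_add[OF this c]
    show "(\<lambda>n. of_int (p' n) / of_int (q' n)) \<longlonglongrightarrow> c" by simp
  next
    fix d :: 'a
    assume "\<forall>p q :: nat \<Rightarrow> int. (\<forall>n. q n \<noteq> 0) \<longrightarrow>
       (\<lambda>n. real_of_int (p n) / real_of_int (q n)) \<longlonglongrightarrow> r \<longrightarrow>
       (\<lambda>n. of_int (p n) / of_int (q n)) \<longlonglongrightarrow> d"
    hence "X \<longlonglongrightarrow> d"
      unfolding X_def using q lim by blast
    thus "d = c"
      using c LIMSEQ_unique by blast
  qed
qed

lemma real_incl_limit:
  assumes "\<And>n. q n \<noteq> 0" "(\<lambda>n. real_of_int (p n) / real_of_int (q n)) \<longlonglongrightarrow> r"
  shows "(\<lambda>n. of_int (p n) / of_int (q n))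
           \<longlonglongrightarrow> (real_incl r :: 'a::{rational_valued_division_ring, complete_space})"
  using theI'[OF real_incl_ex1[of r, where 'a='a]] assms unfolding real_incl_def[symmetric] by blast

lemma real_incl_of_int: "real_incl (real_of_int k) = of_int k"
proof -
  have "(\<lambda>n::nat. of_int k / of_int 1) \<longlonglongrightarrow> real_incl (real_of_int k)"
    by (rule real_incl_limit) auto
  thus ?thesis by (simp add: LIMSEQ_const_iff eq_commute)
qed

lemma real_incl_one: "real_incl 1 = 1"
  using real_incl_of_int[of 1] by simp

lemma real_incl_add: "real_incl (r + s) = real_incl r + real_incl s"
proof -
  obtain p q :: "nat \<Rightarrow> int" where q1: "\<And>n. q n \<noteq> 0"
    and l1: "(\<lambda>n. real_of_int (p n) / real_of_int (q n)) \<longlonglongrightarrow> r"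
    by (rule rational_approx[of r], rule that)
  obtain p' q' :: "nat \<Rightarrow> int" where q2: "\<And>n. q' n \<noteq> 0"
    and l2: "(\<lambda>n. real_of_int (p' n) / real_of_int (q' n)) \<longlonglongrightarrow> s"
    by (rule rational_approx[of s], rule that)
  note q = q1 q2 and l = l1 l2
  have "(\<lambda>n. of_int (p n * q' n + p' n * q n) / of_int (q n * q' n)) \<longlonglongrightarrow> real_incl (r + s)"
    by (rule real_incl_limit) (use q tendsto_add[OF l] in \<open>simp_all add: add_divide_distrib\<close>)
  moreover have "(\<lambda>n. of_int (p n * q' n + p' n * q n) / of_int (q n * q' n))
      \<longlonglongrightarrow> real_incl r + real_incl s"
    using tendsto_value_add[OF real_incl_limit[OF q1 l1] real_incl_limit[OF q2 l2]]
    unfolding frac_add[OF q] .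
  ultimately show ?thesis by (rule LIMSEQ_unique)
qed

lemma real_incl_mult: "real_incl (r * s) = real_incl r * real_incl s"
proof -
  obtain p q :: "nat \<Rightarrow> int" where q1: "\<And>n. q n \<noteq> 0"
    and l1: "(\<lambda>n. real_of_int (p n) / real_of_int (q n)) \<longlonglongrightarrow> r"
    by (rule rational_approx[of r], rule that)
  obtain p' q' :: "nat \<Rightarrow> int" where q2: "\<And>n. q' n \<noteq> 0"
    and l2: "(\<lambda>n. real_of_int (p' n) / real_of_int (q' n)) \<longlonglongrightarrow> s"
    by (rule rational_approx[of s], rule that)
  note q = q1 q2 and l = l1 l2
  have "(\<lambda>n. of_int (p n * p' n) / of_int (q n * q' n)) \<longlonglongrightarrow> real_incl (r * s)"
    by (rule real_incl_limit) (use q tendsto_mult[OF l] in simp_all)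
  moreover have "(\<lambda>n. of_int (p n * p' n) / of_int (q n * q' n)) \<longlonglongrightarrow> real_incl r * real_incl s"
    using tendsto_value_mult[OF real_incl_limit[OF q1 l1] real_incl_limit[OF q2 l2]]
    unfolding frac_mult[OF q] .
  ultimately show ?thesis by (rule LIMSEQ_unique)
qed

lemma real_incl_central: "real_incl r * a = a * real_incl r"
proof -
  obtain p q :: "nat \<Rightarrow> int" where q: "\<And>n. q n \<noteq> 0"
    and l: "(\<lambda>n. real_of_int (p n) / real_of_int (q n)) \<longlonglongrightarrow> r"
    by (rule rational_approx[of r], rule that)
  note lim = real_incl_limit[OF q l, where 'a='a]
  from tendsto_value_mult[OF lim tendsto_const[of a]] tendsto_value_mult[OF tendsto_const[of a] lim]
  show ?thesis
    unfolding frac_central by (rule LIMSEQ_unique)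
qed

lemma value_real_incl: "absval (real_incl r) = \<bar>r\<bar>"
proof -
  obtain p q :: "nat \<Rightarrow> int" where q: "\<And>n. q n \<noteq> 0"
    and l: "(\<lambda>n. real_of_int (p n) / real_of_int (q n)) \<longlonglongrightarrow> r"
    by (rule rational_approx[of r], rule that)
  from tendsto_value[OF real_incl_limit[OF q l]]
  have "(\<lambda>n. \<bar>real_of_int (p n) / real_of_int (q n)\<bar>) \<longlonglongrightarrow> absval (real_incl r)"
    unfolding value_rational[OF q] .
  thus ?thesis
    using LIMSEQ_unique tendsto_rabs[OF l] by blast
qed

lemma vector_space_real_scale: "vector_space real_scale"
  by unfold_locales
     (simp_all add: real_scale_def real_incl_add real_incl_mult real_incl_one algebra_simps)

lemma gateaux_star_real_scale:
  assumes "Vector_Spaces.linear real_scale real_scale f'" and "r \<noteq> 0"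
  shows "gateaux_star f' (real_scale r a) = gateaux_star f' a"
proof (cases "a = 0")
  case False
  have "real_incl r \<noteq> (0::'a)"
    using assms(2) value_real_incl[of r, where 'a='a] value_eq_0_iff[of "real_incl r :: 'a"] by simp
  moreover have "f' (real_incl r * a) = real_incl r * f' a"
    using module_hom.scale[OF Vector_Spaces.linear.axioms(3)[OF assms(1)]]
    by (simp add: real_scale_def)
  ultimately show ?thesis
    using False
    by (simp add: gateaux_star_def real_scale_def nonzero_inverse_mult_distrib mult.assoc)
       (simp flip: mult.assoc)
qed (simp add: gateaux_star_def real_scale_def)

lemma continuous_in_direction_iff:
  assumes "compact {d :: 'a::valued_division_ring. absval d = 1}"
  shows "continuous_in_direction \<phi> \<longleftrightarrow> continuous_on {d :: 'a. absval d = 1} \<phi>"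
proof -
  have "continuous_in_direction \<phi> \<longleftrightarrow> uniformly_continuous_on {d. absval d = 1} \<phi>"
    unfolding continuous_in_direction_def uniformly_continuous_on_def dist_absval by blast
  thus ?thesis
    using assms compact_uniformly_continuous uniformly_continuous_imp_continuous by blast
qed

end

theory Submission
  imports Defs
begin

text \<open>
  A Gateaux derivative \<open>f'\<close> is homogeneous over the reals, so \<open>absval (f' a)\<close> is \<open>absval a\<close> times
  the value of the star derivative in the direction of \<open>a\<close>. On the compact unit sphere the
  star derivative is continuous, hence bounded, and being constant along real rays it is bounded
  on all nonzero elements. Thus \<open>f'\<close> satisfies a Lipschitz bound at \<open>0\<close>
  (\<open>gateaux_derivative_bounded\<close>). In the expansion \<open>f (x + a) - f x = f' a + r a\<close> both terms on
  the right then tend to \<open>0\<close> with \<open>a\<close>: the first by this bound, the second because \<open>r\<close> is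
  continuous and the expansion at \<open>a = 0\<close> gives \<open>r 0 = 0\<close>.
\<close>

text \<open>
  Dividing by \<open>absval a\<close> is a real scaling because the value extends the usual absolute value
  of the reals; this is what ties an arbitrary direction to the sphere.
\<close>

lemma absval_normalize:
  fixes a :: "'a::{rational_valued_division_ring, complete_space}"
  assumes "a \<noteq> 0"
  shows "absval (real_scale (1 / absval a) a) = 1"
  using assms value_nonneg[of a] value_eq_0_iff[of a]
  by (simp add: real_scale_def value_mult value_real_incl)

lemma absval_eq_gateaux_star:
  fixes f' :: "'a::valued_division_ring \<Rightarrow> 'a"
  assumes "a \<noteq> 0"
  shows "absval (f' a) = absval a * absval (gateaux_star f' a)"
proof -
  have "f' a = a * gateaux_star f' a"
    using assms by (simp add: gateaux_star_def flip: mult.assoc)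
  thus ?thesis by (simp only: value_mult)
qed

text \<open>
  A continuous function on the compact sphere is bounded, and a bound for the star derivative on
  the sphere is one in every direction since the star derivative ignores real scaling.
\<close>

lemma gateaux_derivative_bounded:
  fixes f' :: "'a::{rational_valued_division_ring, complete_space} \<Rightarrow> 'a"
  assumes comp: "compact {d :: 'a. absval d = 1}"
    and lin: "Vector_Spaces.linear real_scale real_scale f'"
    and dir: "continuous_in_direction (gateaux_star f')"
  obtains C where "\<And>a. absval (f' a) \<le> C * absval a"
proof -
  have "continuous_on {d :: 'a. absval d = 1} (gateaux_star f')"
    using dir continuous_in_direction_iff[OF comp] by blast
  hence "bounded (gateaux_star f' ` {d. absval d = 1})"
    using comp compact_continuous_image compact_imp_bounded by blast
  then obtain C where C: "\<And>u. absval u = 1 \<Longrightarrow> absval (gateaux_star f' u) \<le> C"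
    unfolding bounded_any_center[of _ 0] by (auto simp: dist_absval value_minus)
  have "absval (f' a) \<le> C * absval a" for a
  proof (cases "a = 0")
    case True
    have "f' 0 = 0"
      using module_hom.zero[OF Vector_Spaces.linear.axioms(3)[OF lin]] .
    with True show ?thesis using value_eq_0_iff[of "0::'a"] by simp
  next
    case False
    hence "absval (gateaux_star f' a) = absval (gateaux_star f' (real_scale (1 / absval a) a))"
      by (subst gateaux_star_real_scale[OF lin]) (simp_all add: value_eq_0_iff)
    also have "\<dots> \<le> C"
      by (rule C[OF absval_normalize[OF False]])
    finally have "absval a * absval (gateaux_star f' a) \<le> absval a * C"
      using value_nonneg[of a] by (rule mult_left_mono)
    thus ?thesis
      using absval_eq_gateaux_star[OF False, of f'] by (simp only: mult.commute[of C])
  qed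
  thus ?thesis by (rule that)
qed

theorem theorem5p2p18:
  fixes f f' :: "'a::{rational_valued_division_ring, complete_space} \<Rightarrow> 'a"
    and x :: 'a
  assumes "compact {d :: 'a. absval d = 1}"
    and "has_gateaux_derivative f f' x"
    and "continuous_in_direction (gateaux_star f')"
  shows "isCont f x"
proof -
  from assms(2) obtain r where lin: "Vector_Spaces.linear real_scale real_scale f'"
    and cont: "continuous_on UNIV r" and exp: "\<And>a. f (x + a) - f x = f' a + r a"
    unfolding has_gateaux_derivative_def by blast
  obtain C where C: "\<And>a. absval (f' a) \<le> C * absval a"
    using gateaux_derivative_bounded[OF assms(1) lin assms(3)] by blast
  have "f' 0 = 0"
    using C[of 0] value_nonneg[of "f' 0"] value_eq_0_iff[of "f' 0"] value_eq_0_iff[of "0::'a"]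
    by simp
  hence r0: "r 0 = 0" using exp[of 0] by simp
  show ?thesis
    unfolding continuous_at_sequentially
  proof (intro allI impI)
    fix X assume X: "X \<longlonglongrightarrow> x"
    define A where "A n = X n - x" for n
    have A: "A \<longlonglongrightarrow> 0"
      using X by (simp add: tendsto_iff_value A_def)
    have "(\<lambda>n. r (A n)) \<longlonglongrightarrow> r 0"
      using continuous_on_tendsto_compose[OF cont A] by simp
    hence "(\<lambda>n. absval (r (A n))) \<longlonglongrightarrow> 0"
      by (simp add: tendsto_iff_value r0)
    moreover have "(\<lambda>n. C * absval (A n)) \<longlonglongrightarrow> 0"
      using A by (intro tendsto_mult_right_zero) (simp add: tendsto_iff_value)
    ultimately have lim: "(\<lambda>n. C * absval (A n) + absval (r (A n))) \<longlonglongrightarrow> 0"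
      using tendsto_add[of _ 0 _ _ 0] by simp
    have "absval (f (X n) - f x) \<le> C * absval (A n) + absval (r (A n))" for n
      using exp[of "A n"] C[of "A n"] value_triangle[of "f' (A n)" "r (A n)"]
      by (simp add: A_def)
    hence "(\<lambda>n. absval (f (X n) - f x)) \<longlonglongrightarrow> 0"
      by (intro Lim_null_comparison[OF _ lim]) (simp add: value_nonneg)
    thus "(f \<circ> X) \<longlonglongrightarrow> f x"
      by (simp add: tendsto_iff_value)
  qed
qed

end
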